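(* Let $=_m$ be the equivalence relation on $\beta N$ given by $x =_m y$ iff $x \mid_m y$ and $y \mid_m x$, and write $[x]_m$ for the equivalence class of $x$. Then: (a) if $x \in K(\beta N)$, then $[x]_m = K(\beta N)$, and $[x]_m$ has $2^{c}$ elements; (b) the relation $=_m$ has exactly one equivalence class on $K(\beta N)$, i.e. all elements of $K(\beta N)$ constitute a single equivalence class of $=_m$.
   Context: $N=\{1,2,3,\dots\}$ is the discrete semigroup of natural numbers under multiplication; $\beta N$ is its Stone–Čech compactification, i.e. the set of all ultrafilters on $N$ (with $n\in N$ identified with the principal ultrafilter at $n$). The multiplication on $\beta N$ is defined by: $A\in x\cdot y$ iff $\{n\in N : A/n\in y\}\in x$, where $A/n=\{m\in N : mn\in A\}$. $K(\beta N)$ denotes the smallest (nonempty, two-sided) ideal of the semigroup $(\beta N,\cdot)$, i.e. the ideal contained in all other ideals. For $x,y\in\beta N$, $x\mid_m y$ ("$y$ is mid-divisible by $x$") means there exist $z,w\in\beta N$ with $y=zxw$. $c=|\mathbb{R}|$. *)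

theory Defs
  imports Complex_Main "HOL-Library.Equipollence"
begin

section \<open>The semigroup \<open>\<beta>N\<close>\<close>

definition is_ultrafilter :: "'a filter \<Rightarrow> bool" where
  "is_ultrafilter F \<longleftrightarrow>
     F \<noteq> bot \<and> (\<forall>P. eventually P F \<or> eventually (\<lambda>x. \<not> P x) F)"

text \<open>
  A set \<open>A\<close> belongs to a filter \<open>F\<close> iff \<open>eventually (\<lambda>n. n \<in> A) F\<close>. As \<open>N\<close> starts at 1
  whereas \<^typ>\<open>nat\<close> contains 0, the ultrafilters on \<open>N\<close> are represented by the ultrafilters
  on \<^typ>\<open>nat\<close> to which \<open>N = {n. 0 < n}\<close> belongs.
\<close>

typedef betaN = "{F :: nat filter. is_ultrafilter F \<and> eventually (\<lambda>n. 0 < n) F}"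
  morphisms filter_of Abs_betaN
proof
  show "principal {1::nat} \<in> {F. is_ultrafilter F \<and> eventually (\<lambda>n. 0 < n) F}"
    by (auto simp: is_ultrafilter_def eventually_principal principal_eq_bot_iff)
qed

setup_lifting type_definition_betaN

lemma eventually_not_ultrafilter:
  assumes "is_ultrafilter F"
  shows "eventually (\<lambda>x. \<not> P x) F \<longleftrightarrow> \<not> eventually P F"
proof
  assume "eventually (\<lambda>x. \<not> P x) F"
  then show "\<not> eventually P F"
    using assms eventually_conj[of P F "\<lambda>x. \<not> P x"]
    by (auto simp: is_ultrafilter_def trivial_limit_def)
qed (use assms in \<open>auto simp: is_ultrafilter_def\<close>)

definition filter_mult :: "nat filter \<Rightarrow> nat filter \<Rightarrow> nat filter" where
  "filter_mult x y = Abs_filter (\<lambda>P. eventually (\<lambda>n. eventually (\<lambda>m. P (m * n)) y) x)"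

lemma eventually_filter_mult:
  "eventually P (filter_mult x y) \<longleftrightarrow> eventually (\<lambda>n. eventually (\<lambda>m. P (m * n)) y) x"
  unfolding filter_mult_def
proof (rule eventually_Abs_filter, unfold_locales)
  fix P Q :: "nat \<Rightarrow> bool"
  assume "eventually (\<lambda>n. eventually (\<lambda>m. P (m * n)) y) x"
    and "eventually (\<lambda>n. eventually (\<lambda>m. Q (m * n)) y) x"
  then show "eventually (\<lambda>n. eventually (\<lambda>m. P (m * n) \<and> Q (m * n)) y) x"
    by eventually_elim (rule eventually_conj)
next
  fix P Q :: "nat \<Rightarrow> bool"
  assume "\<forall>n. P n \<longrightarrow> Q n" and "eventually (\<lambda>n. eventually (\<lambda>m. P (m * n)) y) x"
  then show "eventually (\<lambda>n. eventually (\<lambda>m. Q (m * n)) y) x"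
    by (auto elim!: eventually_mono)
qed simp

instantiation betaN :: monoid_mult
begin

lift_definition one_betaN :: betaN is "principal {1}"
  by (auto simp: is_ultrafilter_def eventually_principal principal_eq_bot_iff)

lift_definition times_betaN :: "betaN \<Rightarrow> betaN \<Rightarrow> betaN" is filter_mult
proof (intro conjI)
  fix x y :: "nat filter"
  assume x: "is_ultrafilter x \<and> eventually (\<lambda>n. 0 < n) x"
    and y: "is_ultrafilter y \<and> eventually (\<lambda>n. 0 < n) y"
  show "is_ultrafilter (filter_mult x y)"
    using x y unfolding is_ultrafilter_def[of "filter_mult x y"] trivial_limit_def
    by (simp add: eventually_filter_mult eventually_not_ultrafilter)
       (auto simp: is_ultrafilter_def)
  have ev: "eventually (\<lambda>m. 0 < m * n) y" if "0 < n" for n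
    using conjunct2[OF y] by eventually_elim (use that in simp)
  show "eventually (\<lambda>n. 0 < n) (filter_mult x y)"
    unfolding eventually_filter_mult using conjunct2[OF x] by eventually_elim (rule ev)
qed

instance
proof
  fix x y z :: betaN
  show "x * y * z = x * (y * z)"
    by transfer (simp add: filter_eq_iff eventually_filter_mult mult.assoc)
  show "1 * x = x"
    by transfer (simp add: filter_eq_iff eventually_filter_mult eventually_principal)
  show "x * 1 = x"
    by transfer (simp add: filter_eq_iff eventually_filter_mult eventually_principal)
qed

end

text \<open>
  The multiplication is the usual one: \<open>A \<in> x \<cdot> y\<close> iff \<open>{n \<in> N. A/n \<in> y} \<in> x\<close>,
  where \<open>A/n = {m \<in> N. m * n \<in> A}\<close>.
\<close>

lemma mem_times_betaN_iff:
  "eventually (\<lambda>k. k \<in> A) (filter_of (x * y)) \<longleftrightarrow>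
   eventually (\<lambda>n. n \<in> {n. 0 < n \<and>
     eventually (\<lambda>m. m \<in> {m. 0 < m \<and> m * n \<in> A}) (filter_of y)}) (filter_of x)"
  by transfer (simp add: eventually_filter_mult eventually_conj_iff)


section \<open>Ideals and mid-divisibility\<close>

definition is_ideal :: "'a::semigroup_mult set \<Rightarrow> bool" where
  "is_ideal I \<longleftrightarrow> I \<noteq> {} \<and> (\<forall>a\<in>I. \<forall>s. s * a \<in> I \<and> a * s \<in> I)"

text \<open>\<open>LEAST\<close> refers to the inclusion order on sets.\<close>

definition K_beta :: "betaN set" where
  "K_beta = (LEAST I. is_ideal I)"

definition mid_dvd :: "betaN \<Rightarrow> betaN \<Rightarrow> bool" (infix \<open>mdvd\<close> 50) where
  "x mdvd y \<longleftrightarrow> (\<exists>z w. y = z * x * w)"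

definition mid_eq :: "(betaN \<times> betaN) set" where
  "mid_eq = {(x, y). x mdvd y \<and> y mdvd x}"

lemma mid_dvd_refl: "x mdvd x"
  unfolding mid_dvd_def by (metis mult_1_left mult_1_right)

lemma mid_dvd_trans: "x mdvd y \<Longrightarrow> y mdvd z \<Longrightarrow> x mdvd z"
  unfolding mid_dvd_def by (metis mult.assoc)

lemma equiv_mid_eq: "equiv UNIV mid_eq"
  by (rule equivI)
     (auto simp: mid_eq_def refl_on_def sym_def intro!: transI
           intro: mid_dvd_refl mid_dvd_trans)

definition mid_class :: "betaN \<Rightarrow> betaN set" where
  "mid_class x = mid_eq `` {x}"

end

theory Submission
  imports Defs "HOL-Analysis.Abstract_Topology_2" "HOL-Computational_Algebra.Primes"
begin

text \<open>
  The statements about \<open>=\<^sub>m\<close> hold for formal reasons once \<open>\<beta>N\<close> has a smallest ideal \<open>K\<close>: the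
  elements mid-divisible by a given \<open>x\<close> form an ideal, so all of \<open>K\<close> is mid-divisible by \<open>x\<close>
  (\<open>mid_dvd_K_beta\<close>), and whatever an element of \<open>K\<close> mid-divides lies in \<open>K\<close>. Hence \<open>K\<close> is a single
  class. The two substantial points are the existence and the size of \<open>K\<close>.

  Existence. It suffices that \<open>\<beta>N\<close> has a minimal left ideal, for that is contained in every ideal, so
  that the intersection of all ideals is again an ideal. Usually a minimal left ideal comes from the
  compactness of \<open>\<beta>N\<close>. Here the topology is replaced by filters: a closed set of ultrafilters is the
  set of all ultrafilters finer than some filter \<open>F\<close>, and it is a left ideal if \<open>F\<close> is invariant
  under all maps \<open>m \<mapsto> m * n\<close> with \<open>0 < n\<close>. By Zorn's lemma there is a maximally fine proper invariant filter on \<open>N\<close>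
  (\<open>minimal_invariant_filter\<close>), which yields the minimal left ideal (\<open>minimal_left_ideal_exists\<close>).

  Size. Being a set of ultrafilters, \<open>K\<close> has at most \<open>2\<^sup>c\<close> elements. Conversely, every ideal \<open>I\<close> has at
  least as many (\<open>lepoll_ideal\<close>). The largest prime factor is a homomorphism from multiplication to
  \<open>max\<close>, and it extends to \<open>\<beta>N\<close>. If \<open>q\<close> is a nonprincipal ultrafilter on the primes, then
  multiplying any \<open>k\<close> by \<open>q\<close> gives an element whose largest prime factor is distributed according
  to \<open>q\<close>, because \<open>q\<close>-almost every prime exceeds any given \<open>n\<close>. Thus \<open>q\<close> can be recovered from
  \<open>k * q\<close>; fixing \<open>k \<in> I\<close>, the map \<open>q \<mapsto> k * q\<close> is an injection into \<open>I\<close>. Finally, the independent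
  family of Fichtenholz, Kantorovich and Hausdorff provides \<open>2\<^sup>c\<close> nonprincipal ultrafilters on a
  countable set (\<open>ultrafilter_capturing_exactly\<close>).
\<close>

section \<open>Minimal invariant filters and the ultrafilter lemma\<close>

text \<open>
  Zorn's lemma applies because the infimum of a chain of proper filters is their union as families
  of sets; it therefore stays proper and invariant. For \<open>H = {}\<close> the minimal filters are exactly the
  ultrafilters; for the multiplications \<open>m \<mapsto> m * n\<close> with \<open>0 < n\<close>, and with \<open>F0\<close> generated by the set of
  positive numbers, they correspond to the minimal closed left ideals of \<open>\<beta>N\<close>.
\<close>

lemma minimal_invariant_filter:
  fixes F0 :: "'a filter" and H :: "('a \<Rightarrow> 'a) set"
  assumes "F0 \<noteq> bot" and "\<And>h. h \<in> H \<Longrightarrow> filtermap h F0 \<le> F0"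
  obtains F where "F \<noteq> bot" "F \<le> F0" "\<forall>h\<in>H. filtermap h F \<le> F"
    "\<forall>G. G \<noteq> bot \<longrightarrow> G \<le> F \<longrightarrow> (\<forall>h\<in>H. filtermap h G \<le> G) \<longrightarrow> G = F"
proof -
  define A where "A = {F. F \<noteq> bot \<and> F \<le> F0 \<and> (\<forall>h\<in>H. filtermap h F \<le> F)}"
  have "\<exists>F\<in>A. \<forall>G\<in>A. G \<le> F \<longrightarrow> G = F"
  proof (rule predicate_Zorn)
    show "partial_order_on A (relation_of (\<lambda>x y. y \<le> x) A)"
      by (rule partial_order_on_relation_ofI) auto
    fix C assume C: "C \<in> Chains (relation_of (\<lambda>x y. y \<le> x) A)"
    then have sub: "C \<subseteq> A" and lin: "\<And>F G. F \<in> C \<Longrightarrow> G \<in> C \<Longrightarrow> F \<le> G \<or> G \<le> F"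
      by (auto simp: Chains_def relation_of_def)
    show "\<exists>u\<in>A. \<forall>a\<in>C. u \<le> a"
    proof (cases "C = {}")
      case True
      then show ?thesis using assms by (auto simp: A_def)
    next
      case False
      have ev: "eventually P (Inf C) \<longleftrightarrow> (\<exists>F\<in>C. eventually P F)" for P
        using False lin by (intro eventually_Inf_base) (metis inf.orderE inf.commute order_refl)+
      have "Inf C \<noteq> bot"
        using sub by (auto simp: trivial_limit_def ev A_def)
      moreover obtain F where "F \<in> C" using False by blast
      then have "Inf C \<le> F0"
        using sub by (auto simp: A_def intro: Inf_lower2)
      moreover have "filtermap h (Inf C) \<le> Inf C" if "h \<in> H" for h
        unfolding le_filter_def eventually_filtermap ev
      proof (intro allI impI)
        fix P assume "\<exists>F\<in>C. eventually P F"
        then obtain F where "F \<in> C" "eventually P F" by blast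
        moreover from this have "filtermap h F \<le> F"
          using sub that by (auto simp: A_def)
        ultimately show "\<exists>F\<in>C. eventually (\<lambda>x. P (h x)) F"
          by (auto simp: le_filter_def eventually_filtermap)
      qed
      ultimately have "Inf C \<in> A" by (auto simp: A_def)
      then show ?thesis by (auto intro: Inf_lower)
    qed
  qed
  then show thesis
    using that unfolding A_def by (smt (verit) mem_Collect_eq order_trans)
qed

lemma ultrafilter_below_exists:
  assumes "F \<noteq> bot"
  obtains U where "is_ultrafilter U" "U \<le> F"
proof -
  obtain U where U: "U \<noteq> bot" "U \<le> F" and minimal: "\<And>G. G \<noteq> bot \<Longrightarrow> G \<le> U \<Longrightarrow> G = U"
    using minimal_invariant_filter[of F "{}"] assms by auto
  have "eventually P U \<or> eventually (\<lambda>x. \<not> P x) U" for P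
  proof (cases "inf U (principal {x. P x}) = bot")
    case True
    then show ?thesis
      by (auto simp: trivial_limit_def eventually_inf_principal)
  next
    case False
    then have "inf U (principal {x. P x}) = U"
      by (rule minimal) simp
    then have "U \<le> principal {x. P x}"
      by (metis inf_le2)
    then show ?thesis by (auto simp: le_principal)
  qed
  then show thesis using U that by (auto simp: is_ultrafilter_def)
qed

section \<open>The minimal left ideal and the smallest ideal\<close>

lemma eventually_times_betaN:
  "eventually P (filter_of (x * y)) \<longleftrightarrow>
   eventually (\<lambda>n. eventually (\<lambda>m. P (m * n)) (filter_of y)) (filter_of x)"
  by transfer (rule eventually_filter_mult)

lemma ultrafilter_filter_of: "is_ultrafilter (filter_of x)"
  and eventually_pos_filter_of: "eventually (\<lambda>n. 0 < n) (filter_of x)"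
  using filter_of[of x] by auto

lemma betaN_eqI:
  assumes "\<And>P. eventually P (filter_of x) \<Longrightarrow> eventually P (filter_of y)"
  shows "x = y"
proof -
  have "eventually P (filter_of x) \<longleftrightarrow> eventually P (filter_of y)" for P
    using assms[of P] assms[of "\<lambda>n. \<not> P n"]
    by (auto simp: eventually_not_ultrafilter ultrafilter_filter_of)
  then show ?thesis
    by (simp add: filter_eq_iff flip: filter_of_inject)
qed

lemma betaN_below_exists:
  assumes "F \<noteq> bot" "eventually (\<lambda>n. 0 < n) F"
  obtains x where "filter_of x \<le> F"
proof -
  obtain U where U: "is_ultrafilter U" "U \<le> F"
    using ultrafilter_below_exists[OF assms(1)] .
  then have "filter_of (Abs_betaN U) = U"
    using filter_leD[OF U(2) assms(2)] by (intro Abs_betaN_inverse) auto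
  then show thesis using U(2) that by metis
qed

text \<open>
  The hypothesis says that \<open>u\<close> lies in the closure of \<open>{n * y | n. 0 < n}\<close>, and the left ideal
  \<open>\<beta>N * y\<close> is already closed. The factor \<open>x\<close> is an ultrafilter containing, for each \<open>P\<close> in \<open>u\<close>, the
  set \<open>S P\<close> of all \<open>n\<close> such that \<open>P\<close> belongs to \<open>n * y\<close>. These sets are closed under finite
  intersections, and an empty one would put the complement of \<open>P\<close> into every \<open>n * y\<close>, hence into \<open>u\<close>.
\<close>

lemma mem_left_ideal_generated:
  assumes u: "\<And>P. (\<And>n. 0 < n \<Longrightarrow> eventually (\<lambda>m. P (m * n)) (filter_of y))
                \<Longrightarrow> eventually P (filter_of u)"
  obtains x where "u = x * y"
proof -
  define S where "S P = {n. 0 < n \<and> eventually (\<lambda>m. P (m * n)) (filter_of y)}" for P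
  define F where "F = (INF P\<in>{P. eventually P (filter_of u)}. principal (S P))"
  have ev: "eventually Q F \<longleftrightarrow> (\<exists>P\<in>{P. eventually P (filter_of u)}. eventually Q (principal (S P)))" for Q
    unfolding F_def
  proof (rule eventually_INF_base)
    fix P Q
    assume "P \<in> {P. eventually P (filter_of u)}" "Q \<in> {P. eventually P (filter_of u)}"
    then show "\<exists>R\<in>{P. eventually P (filter_of u)}.
        principal (S R) \<le> inf (principal (S P)) (principal (S Q))"
      by (intro bexI[of _ "\<lambda>n. P n \<and> Q n"]) (auto simp: S_def eventually_conj_iff)
  qed (auto intro: exI[of _ "\<lambda>_. True"])
  have "S P \<noteq> {}" if P: "eventually P (filter_of u)" for P
  proof
    assume "S P = {}"
    then have empty: "n \<notin> S P" for n by blast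
    have "eventually (\<lambda>m. \<not> P (m * n)) (filter_of y)" if "0 < n" for n
      using that empty[of n] by (simp add: S_def eventually_not_ultrafilter ultrafilter_filter_of)
    then have "eventually (\<lambda>n. \<not> P n) (filter_of u)" by (rule u)
    with P show False by (simp add: eventually_not_ultrafilter ultrafilter_filter_of)
  qed
  then have "F \<noteq> bot"
    by (auto simp: trivial_limit_def ev eventually_principal)
  moreover have "eventually (\<lambda>n. 0 < n) F"
    by (auto simp: ev eventually_principal S_def intro: exI[of _ "\<lambda>_. True"])
  ultimately obtain x where x: "filter_of x \<le> F"
    by (rule betaN_below_exists)
  have "u = x * y"
  proof (rule betaN_eqI)
    fix P assume "eventually P (filter_of u)"
    then have "eventually (\<lambda>n. eventually (\<lambda>m. P (m * n)) (filter_of y)) F"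
      by (auto simp: ev eventually_principal S_def)
    then show "eventually P (filter_of (x * y))"
      unfolding eventually_times_betaN using x by (rule filter_leD[rotated])
  qed
  then show thesis by (rule that)
qed

text \<open>
  The last property expresses minimality: \<open>L = \<beta>N * y\<close> for every \<open>y \<in> L\<close>. It holds because the
  filter \<open>G\<close> of the closed left ideal \<open>\<beta>N * y\<close> is itself invariant and finer than the minimal filter
  \<open>F\<close> that defines \<open>L\<close>, so the two filters coincide.
\<close>

lemma minimal_left_ideal_exists:
  obtains L :: "betaN set" where "L \<noteq> {}" "\<forall>x. \<forall>y\<in>L. x * y \<in> L"
    "\<forall>y\<in>L. \<forall>u\<in>L. \<exists>x. u = x * y"
proof -
  define H :: "(nat \<Rightarrow> nat) set" where "H = (\<lambda>n m. m * n) ` {0<..}"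
  have "principal {0<..} \<noteq> (bot :: nat filter)"
    by (auto simp: principal_eq_bot_iff)
  moreover have "filtermap h (principal {0<..}) \<le> principal {0<..}" if "h \<in> H" for h
    using that by (auto simp: H_def)
  ultimately obtain F where F: "F \<noteq> bot" "F \<le> principal {0<..}"
    and inv: "\<forall>h\<in>H. filtermap h F \<le> F"
    and minimal: "\<forall>G. G \<noteq> bot \<longrightarrow> G \<le> F \<longrightarrow> (\<forall>h\<in>H. filtermap h G \<le> G) \<longrightarrow> G = F"
    by (rule minimal_invariant_filter)
  have shift: "eventually (\<lambda>m. P (m * n)) F" if "eventually P F" "0 < n" for P n
    using bspec[OF inv, of "\<lambda>m. m * n"] that
    by (auto simp: H_def le_filter_def eventually_filtermap)
  define L where "L = {x. filter_of x \<le> F}"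
  show thesis
  proof (rule that[of L]; (intro allI ballI)?)
    show "L \<noteq> {}"
      using betaN_below_exists[of F] F by (auto simp: L_def le_principal)
    show "x * y \<in> L" if "y \<in> L" for x y
    proof -
      have "eventually P (filter_of (x * y))" if "eventually P F" for P
        unfolding eventually_times_betaN using eventually_pos_filter_of[of x]
        by eventually_elim (use shift[OF that] \<open>y \<in> L\<close> in \<open>auto simp: L_def le_filter_def\<close>)
      then show ?thesis by (auto simp: L_def le_filter_def)
    qed
    show "\<exists>x. u = x * y" if "y \<in> L" "u \<in> L" for y u
    proof -
      define G where "G = (SUP n\<in>{0<..}. filtermap (\<lambda>m. m * n) (filter_of y))"
      have ev: "eventually P G \<longleftrightarrow> (\<forall>n>0. eventually (\<lambda>m. P (m * n)) (filter_of y))" for P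
        by (auto simp: G_def eventually_Sup eventually_filtermap)
      have "G = F"
      proof (rule minimal[rule_format])
        show "G \<noteq> bot"
          using ultrafilter_filter_of[of y]
          by (auto simp: trivial_limit_def ev is_ultrafilter_def)
        show "G \<le> F"
          using shift \<open>y \<in> L\<close> by (auto simp: L_def le_filter_def ev)
        show "filtermap h G \<le> G" if "h \<in> H" for h
          using that by (auto simp: H_def le_filter_def eventually_filtermap ev mult.assoc)
      qed
      then have "eventually P (filter_of u)"
        if "\<And>n. 0 < n \<Longrightarrow> eventually (\<lambda>m. P (m * n)) (filter_of y)" for P
        using that \<open>u \<in> L\<close> ev[of P] by (auto simp: L_def le_filter_def)
      then show ?thesis by (metis mem_left_ideal_generated)
    qed
  qed
qed

text \<open>
  A minimal left ideal \<open>L\<close> lies in every ideal \<open>I\<close>: for \<open>a \<in> I\<close> and \<open>u \<in> L\<close> the product \<open>a * u\<close> is in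
  both, and minimality makes \<open>u\<close> a left multiple of it. So the intersection of all ideals is
  nonempty, and it is the least ideal.
\<close>

lemma ideal_K_beta: "is_ideal K_beta"
  and K_beta_subset_ideal: "is_ideal I \<Longrightarrow> K_beta \<subseteq> I"
proof -
  obtain L :: "betaN set" where L: "L \<noteq> {}" "\<forall>x. \<forall>y\<in>L. x * y \<in> L"
    "\<forall>y\<in>L. \<forall>u\<in>L. \<exists>x. u = x * y"
    by (rule minimal_left_ideal_exists)
  have L_subset: "L \<subseteq> I" if I: "is_ideal I" for I
  proof
    fix u assume "u \<in> L"
    obtain a where "a \<in> I" using I by (auto simp: is_ideal_def)
    then have "a * u \<in> I" using I by (auto simp: is_ideal_def)
    moreover obtain x where "u = x * (a * u)"
      using L \<open>u \<in> L\<close> by metis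
    ultimately show "u \<in> I" using I by (metis is_ideal_def)
  qed
  define M :: "betaN set" where "M = \<Inter>{I. is_ideal I}"
  have M: "is_ideal M"
    unfolding is_ideal_def[of M]
  proof (intro conjI ballI allI)
    show "M \<noteq> {}" using L(1) L_subset by (auto simp: M_def)
    fix a s assume "a \<in> M"
    then show "s * a \<in> M" "a * s \<in> M"
      by (auto simp: M_def is_ideal_def)
  qed
  then have "K_beta = M"
    unfolding K_beta_def by (intro Least_equality) (auto simp: M_def)
  then show "is_ideal K_beta" and "is_ideal I \<Longrightarrow> K_beta \<subseteq> I"
    using M by (auto simp: M_def)
qed

text \<open>
  The elements mid-divisible by \<open>x\<close> form an ideal, and \<open>K_beta\<close> is contained in every ideal.
\<close>

lemma mid_dvd_K_beta:
  assumes "y \<in> K_beta"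
  shows "x mdvd y"
proof -
  have "is_ideal {y. x mdvd y}"
    unfolding is_ideal_def
  proof (intro conjI ballI allI)
    show "{y. x mdvd y} \<noteq> {}" using mid_dvd_refl by blast
    fix y s assume y: "y \<in> {y. x mdvd y}"
    have "s * y = s * y * 1" "y * s = 1 * y * s" by simp_all
    then have "y mdvd s * y" "y mdvd y * s"
      unfolding mid_dvd_def by blast+
    then show "s * y \<in> {y. x mdvd y}" "y * s \<in> {y. x mdvd y}"
      using y by (auto intro: mid_dvd_trans)
  qed
  then show ?thesis
    using K_beta_subset_ideal assms by blast
qed

lemma mid_class_K_beta:
  assumes x: "x \<in> K_beta"
  shows "mid_class x = K_beta"
proof -
  have "y \<in> K_beta" if "x mdvd y" for y
    using that x ideal_K_beta by (auto simp: mid_dvd_def is_ideal_def)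
  then show ?thesis
    using x by (auto simp: mid_class_def mid_eq_def mid_dvd_K_beta)
qed

section \<open>An independent family of sets and its ultrafilters\<close>

lemma eventually_initial_segments_distinguish:
  fixes Y :: "nat set set"
  assumes "finite Y"
  shows "eventually (\<lambda>N. inj_on (\<lambda>X. filter (\<lambda>i. i \<in> X) [0..<N]) Y) sequentially"
proof -
  have "eventually (\<lambda>N. filter (\<lambda>i. i \<in> X) [0..<N] = filter (\<lambda>i. i \<in> Z) [0..<N] \<longrightarrow> X = Z)
      sequentially" for X Z :: "nat set"
  proof (cases "X = Z")
    case False
    then obtain k where k: "k \<in> X \<longleftrightarrow> k \<notin> Z" by blast
    show ?thesis
      using eventually_gt_at_top[of k]
    proof eventually_elim
      case (elim N)
      then have "k \<in> set (filter (\<lambda>i. i \<in> X) [0..<N]) \<longleftrightarrow> k \<notin> set (filter (\<lambda>i. i \<in> Z) [0..<N])"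
        using k by auto
      then show ?case by metis
    qed
  qed simp
  then show ?thesis
    unfolding inj_on_def using assms by (intro eventually_ball_finite ballI)
qed

text \<open>
  A pair \<open>(N, ys)\<close> lists finitely many subsets of the initial segment below \<open>N\<close>, each written as an
  increasing list; it captures \<open>X\<close> if the trace of \<open>X\<close> on that segment is among them. The sets
  \<open>{d. captures X d}\<close>, indexed by the subsets \<open>X\<close> of \<open>nat\<close>, form the classical independent family of
  size continuum. Lists stand in for finite sets to keep the type of pairs countable.
\<close>

definition captures :: "nat set \<Rightarrow> (nat \<times> nat list list) \<Rightarrow> bool" where
  "captures X d \<longleftrightarrow> filter (\<lambda>i. i \<in> X) [0..<fst d] \<in> set (snd d)"

text \<open>
  This is independence: finitely many sets have distinct traces on a sufficiently long initial
  segment, so that a pair capturing exactly the ones in \<open>T\<close> can be written down, with \<open>N\<close> as large as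
  desired. The condition \<open>n < fst d\<close> makes \<open>U\<close> nonprincipal.
\<close>

lemma ultrafilter_capturing_exactly:
  fixes T :: "nat set set"
  obtains U where "is_ultrafilter U"
    "\<And>X. eventually (\<lambda>d. captures X d \<longleftrightarrow> X \<in> T) U"
    "\<And>n. eventually (\<lambda>d. n < fst d) U"
proof -
  define S where "S = (\<lambda>(X, n). {d. (captures X d \<longleftrightarrow> X \<in> T) \<and> n < fst d})"
  define F where "F = (INF i\<in>UNIV. principal (S i))"
  have "F \<noteq> bot"
    unfolding F_def
  proof (rule INF_filter_not_bot)
    fix J :: "(nat set \<times> nat) set"
    assume "finite J"
    have "eventually (\<lambda>N. inj_on (\<lambda>X. filter (\<lambda>i. i \<in> X) [0..<N]) (fst ` J) \<and> (\<forall>i\<in>J. snd i < N))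
        sequentially"
      using \<open>finite J\<close> by (intro eventually_conj eventually_initial_segments_distinguish
          eventually_ball_finite ballI eventually_gt_at_top) auto
    then obtain N where inj: "inj_on (\<lambda>X. filter (\<lambda>i. i \<in> X) [0..<N]) (fst ` J)"
      and N: "\<forall>i\<in>J. snd i < N"
      by (auto simp: eventually_sequentially)
    obtain ys where ys: "set ys = (\<lambda>X. filter (\<lambda>i. i \<in> X) [0..<N]) ` (fst ` J \<inter> T)"
      using \<open>finite J\<close> by (meson finite_Int finite_imageI finite_list)
    have "(N, ys) \<in> S i" if "i \<in> J" for i
      using that N inj by (force simp: S_def captures_def ys inj_on_def split: prod.split)
    then have "(\<Inter>i\<in>J. S i) \<noteq> {}" by blast
    then show "(INF i\<in>J. principal (S i)) \<noteq> bot"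
      using \<open>finite J\<close> by (simp add: INF_principal_finite principal_eq_bot_iff)
  qed
  then obtain U where U: "is_ultrafilter U" "U \<le> F"
    by (rule ultrafilter_below_exists)
  have "eventually (\<lambda>d. d \<in> S i) U" for i
    using U(2) by (cases i) (simp add: F_def le_INF_iff le_principal)
  then have ev: "eventually (\<lambda>d. (captures X d \<longleftrightarrow> X \<in> T) \<and> n < fst d) U" for X n
    by (auto simp: S_def split: prod.splits)
  show thesis
  proof (rule that[OF U(1)])
    show "eventually (\<lambda>d. captures X d \<longleftrightarrow> X \<in> T) U" for X
      using ev[of X 0] by eventually_elim simp
    show "eventually (\<lambda>d. n < fst d) U" for n
      using ev[of "{}" n] by eventually_elim simp
  qed
qed

section \<open>The cardinality of the smallest ideal\<close>

lemma Max_prime_factors_times: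
  fixes p n :: nat
  assumes "prime p" "0 < n" "n < p"
  shows "Max (prime_factors (p * n)) = p"
proof (rule Max_eqI)
  fix q assume "q \<in> prime_factors (p * n)"
  then have "q = p \<or> q dvd n"
    using assms by (auto simp: prime_factors_product prime_prime_factors in_prime_factors_iff)
  then show "q \<le> p"
    using assms by (auto dest: dvd_imp_le)
qed (use assms in \<open>auto simp: in_prime_factors_iff\<close>)

text \<open>
  An injection of the pairs into the primes. The first component is kept as an argument of the
  pairing function so that it bounds the prime from below (\<open>fst_le_prime_code\<close>); an ultrafilter under
  which \<open>fst\<close> eventually exceeds every bound is thereby sent to one that contains no bounded set of primes.
\<close>

definition prime_code :: "nat \<times> nat list list \<Rightarrow> nat" where
  "prime_code d = enumerate {p. prime p} (prod_encode (fst d, to_nat (snd d)))"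

lemma prime_prime_code: "prime (prime_code d)"
  using enumerate_in_set[OF primes_infinite] by (simp add: prime_code_def)

lemma fst_le_prime_code: "fst d \<le> prime_code d"
  unfolding prime_code_def
  using le_enumerate[OF primes_infinite] le_prod_encode_1 order_trans by blast

lemma inj_prime_code: "inj prime_code"
  unfolding prime_code_def
  by (intro injI) (auto simp: strict_mono_eq[OF strict_mono_enumerate[OF primes_infinite]] prod_eq_iff)

lemma betaN_lepoll: "(UNIV :: betaN set) \<lesssim> (UNIV :: nat set set set)"
  unfolding lepoll_def
proof (intro exI conjI)
  show "inj (\<lambda>x. {A. eventually (\<lambda>n. n \<in> A) (filter_of x)})"
  proof (rule injI, rule betaN_eqI)
    fix x y :: betaN and P
    assume "{A. eventually (\<lambda>n. n \<in> A) (filter_of x)} = {A. eventually (\<lambda>n. n \<in> A) (filter_of y)}"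
    then have "eventually (\<lambda>n. n \<in> {n. P n}) (filter_of x) \<longleftrightarrow> eventually (\<lambda>n. n \<in> {n. P n}) (filter_of y)"
      by blast
    then show "eventually P (filter_of x) \<Longrightarrow> eventually P (filter_of y)" by simp
  qed
qed simp

text \<open>
  Fix \<open>k \<in> I\<close>. A family \<open>T\<close> of sets of numbers is sent to \<open>k * q\<close>, where \<open>q\<close> is the image on the primes
  of an ultrafilter capturing exactly the members of \<open>T\<close>. For \<open>q\<close>-almost every prime \<open>p\<close>, the largest
  prime factor of \<open>p * n\<close> is \<open>p\<close>, which decodes to a pair capturing \<open>X\<close> or not according to whether
  \<open>X \<in> T\<close>. So \<open>T\<close> can be read off from \<open>k * q\<close>.
\<close>

lemma lepoll_ideal:
  fixes I :: "betaN set"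
  assumes I: "is_ideal I"
  shows "(UNIV :: nat set set set) \<lesssim> I"
proof -
  obtain k where k: "k \<in> I" using I by (auto simp: is_ideal_def)
  have "\<exists>z\<in>I. \<forall>X. eventually (\<lambda>m. Max (prime_factors m) \<in> prime_code ` {d. captures X d}) (filter_of z)
      \<longleftrightarrow> X \<in> T" for T :: "nat set set"
  proof -
    obtain U where U: "is_ultrafilter U"
      "\<And>X. eventually (\<lambda>d. captures X d \<longleftrightarrow> X \<in> T) U"
      "\<And>n. eventually (\<lambda>d. n < fst d) U"
      by (rule ultrafilter_capturing_exactly[of T]) blast
    have "is_ultrafilter (filtermap prime_code U)"
      using U(1) by (auto simp: is_ultrafilter_def eventually_filtermap filtermap_bot_iff)
    moreover have "eventually (\<lambda>p. 0 < p) (filtermap prime_code U)"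
      by (auto simp: eventually_filtermap prime_gt_0_nat prime_prime_code)
    ultimately have q: "filter_of (Abs_betaN (filtermap prime_code U)) = filtermap prime_code U"
      by (intro Abs_betaN_inverse) auto
    define z where "z = k * Abs_betaN (filtermap prime_code U)"
    have "eventually (\<lambda>m. (Max (prime_factors m) \<in> prime_code ` {d. captures X d}) \<longleftrightarrow> X \<in> T) (filter_of z)"
      for X
      unfolding z_def eventually_times_betaN q eventually_filtermap
      using eventually_pos_filter_of[of k]
    proof eventually_elim
      case (elim n)
      show ?case
        using U(2)[of X] U(3)[of n]
      proof eventually_elim
        case (elim d)
        have "Max (prime_factors (prime_code d * n)) = prime_code d"
          using elim \<open>0 < n\<close> fst_le_prime_code[of d]
          by (intro Max_prime_factors_times prime_prime_code) auto
        then show ?case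
          using elim by (simp add: inj_image_mem_iff[OF inj_prime_code])
      qed
    qed
    note ev = this
    have "eventually (\<lambda>m. Max (prime_factors m) \<in> prime_code ` {d. captures X d}) (filter_of z)
      \<longleftrightarrow> X \<in> T" for X
      using ev[of X] by (cases "X \<in> T") (simp_all add: eventually_not_ultrafilter ultrafilter_filter_of)
    moreover have "z \<in> I" using I k by (auto simp: is_ideal_def z_def)
    ultimately show ?thesis by blast
  qed
  then obtain z where z: "\<And>T. z T \<in> I"
    "\<And>T X. eventually (\<lambda>m. Max (prime_factors m) \<in> prime_code ` {d. captures X d}) (filter_of (z T))
      \<longleftrightarrow> X \<in> T"
    by metis
  have "inj z"
    by (rule injI) (metis z(2) set_eqI)
  then show ?thesis
    using z(1) unfolding lepoll_def by blast
qed

lemma ideal_eqpoll_real_sets: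
  fixes I :: "betaN set"
  assumes "is_ideal I"
  shows "I \<approx> (UNIV :: real set set)"
proof -
  have "(UNIV :: nat set set set) \<approx> (UNIV :: real set set)"
  proof -
    obtain f :: "nat set \<Rightarrow> real" where "bij f"
      using nat_sets_eqpoll_reals by (auto simp: eqpoll_def)
    then show ?thesis
      unfolding eqpoll_def using bij_betw_Pow[of f UNIV UNIV] by auto
  qed
  moreover have "I \<approx> (UNIV :: nat set set set)"
    using lepoll_ideal[OF assms] lepoll_trans[OF subset_imp_lepoll[OF subset_UNIV] betaN_lepoll]
    by (rule lepoll_antisym[rotated])
  ultimately show ?thesis by (rule eqpoll_trans[rotated])
qed

theorem theorem5p7:
  shows "(\<forall>x\<in>K_beta. mid_class x = K_beta \<and> mid_class x \<approx> (UNIV :: real set set))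
    \<and> K_beta // mid_eq = {K_beta}"
proof -
  have "K_beta // mid_eq = {K_beta}"
    using mid_class_K_beta ideal_K_beta
    by (auto simp: quotient_def mid_class_def is_ideal_def)
  then show ?thesis
    using mid_class_K_beta ideal_eqpoll_real_sets[OF ideal_K_beta] by simp
qed

end
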